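(* The vector space of abelian relations of the web on $U$ is isomorphic, via $(f_1,\dots,f_d)\mapsto r=\sum_{i=1}^d f_i\prod_{j\neq i}(p-p_j)$ (a polynomial in $p$ of degree $\le d-3$, identified with $(r_0,\dots,r_{d-3})^T$), to the space of families $r=(r_j)_{0\le j\le d-3}$ of holomorphic functions on $U$ satisfying $$I_0\, r'_x+I^0\, r'_y\equiv M\, r,\qquad\text{where } M=-T\,E.$$
   Context: Let $d\ge 3$, let $U\subset\mathbb{C}^2$ be open with coordinates $(x,y)$, and let $F(x,y,p)=\sum_{i=0}^d a_i(x,y)p^{d-i}$ with $a_i$ holomorphic on $U$, $a_0\equiv1$, such that $F(x,y,p)=\prod_{i=1}^d(p-p_i(x,y))$ with holomorphic $p_i$ pairwise distinct at every point of $U$. The planar $d$-web considered is the superposition of the foliations defined by $y'=p_i(x,y)$. An abelian relation is a family $(f_1,\dots,f_d)$ of holomorphic functions on $U$ with $\sum_i f_i\equiv 0$, $\sum_i p_if_i\equiv0$ and $(f_i)'_x+(p_if_i)'_y\equiv 0$ for each $i$. Subscripts $'_x,'_y,'_p$ denote partial derivatives. Matrix notation: a polynomial $P=\sum_{i=0}^k g_ip^i$ with holomorphic coefficients is identified with the column $(g_0,\dots,g_k)^T$; for an integer $h\ge0$, $M(P)$ is the $(h+k+1)\times(h+1)$ matrix of multiplication by $P$ from polynomials of degree $\le h$ to degree $\le h+k$, with entry in row $i$, column $j$ ($0$-based) equal to $g_{i-j}$ if $0\le i-j\le k$ and $0$ otherwise. Put $K=F'_x+pF'_y$, $H=K\,F''_{pp}-K'_pF'_p$,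 $L=K\,F'_p$. Use $M(F)$ of size $(3d-3)\times(2d-3)$, $M((F'_p)^2)$ of size $(3d-3)\times(d-1)$, and $M(L)$, $M(H)$ of size $(3d-3)\times(d-2)$ (with $L,H$ regarded as polynomials of formal degree $\le 2d-1$). For a matrix $X$ with $3d-3$ rows, $X^+$ is the submatrix of its first $d$ rows and $X^-$ that of its last $2d-3$ rows ($M^-(F)$ is triangular with unit diagonal, hence invertible). Let $N$ be the $(d-2)\times(d-2)$ matrix whose only nonzero entries are $N_{j,j+1}=j$ for $1\le j\le d-3$ (1-based indices), representing $r\mapsto r'_p$. Define the $d\times(d-1)$ matrix $B=M^+((F'_p)^2)-M^+(F)(M^-(F))^{-1}M^-((F'_p)^2)$, which has rank $d-1$, and the $d\times(d-2)$ matrix $E=\bigl(M^+(H)-M^+(L)N\bigr)-M^+(F)(M^-(F))^{-1}\bigl(M^-(H)-M^-(L)N\bigr)$. Let $T$ be any $(d-1)\times d$ left inverse of $B$ ($TB=\mathrm{Id}_{d-1}$). $I_0$ is the $(d-1)\times(d-2)$ matrix consisting of $\mathrm{Id}_{d-2}$ followed by a zero row, and $I^0$ the $(d-1)\times(d-2)$ matrix consisting of a zero row followed by $\mathrm{Id}_{d-2}$. *)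

theory Defs
  imports Complex_Main "HOL-Analysis.Derivative" "HOL-Computational_Algebra.Polynomial"
    "Jordan_Normal_Form.Gauss_Jordan_Elimination"
begin

type_synonym pt = "complex \<times> complex"

definition holo2 :: "pt set \<Rightarrow> (pt \<Rightarrow> complex) \<Rightarrow> bool" where
  "holo2 U f \<longleftrightarrow> (\<forall>z\<in>U. \<exists>\<alpha> \<beta>. (f has_derivative (\<lambda>w. \<alpha> * fst w + \<beta> * snd w)) (at z))"

definition dx :: "(pt \<Rightarrow> complex) \<Rightarrow> pt \<Rightarrow> complex" where
  "dx f z = deriv (\<lambda>t. f (t, snd z)) (fst z)"
definition dy :: "(pt \<Rightarrow> complex) \<Rightarrow> pt \<Rightarrow> complex" where
  "dy f z = deriv (\<lambda>t. f (fst z, t)) (snd z)"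

definition Fpol :: "nat \<Rightarrow> (nat \<Rightarrow> pt \<Rightarrow> complex) \<Rightarrow> pt \<Rightarrow> complex poly" where
  "Fpol d a z = (\<Sum>i\<le>d. monom (a i z) (d - i))"
definition Fxpol :: "nat \<Rightarrow> (nat \<Rightarrow> pt \<Rightarrow> complex) \<Rightarrow> pt \<Rightarrow> complex poly" where
  "Fxpol d a z = (\<Sum>i\<le>d. monom (dx (a i) z) (d - i))"
definition Fypol :: "nat \<Rightarrow> (nat \<Rightarrow> pt \<Rightarrow> complex) \<Rightarrow> pt \<Rightarrow> complex poly" where
  "Fypol d a z = (\<Sum>i\<le>d. monom (dy (a i) z) (d - i))"

definition Kpol where "Kpol d a z = Fxpol d a z + [:0, 1:] * Fypol d a z"
definition Hpol where
  "Hpol d a z = Kpol d a z * pderiv (pderiv (Fpol d a z)) - pderiv (Kpol d a z) * pderiv (Fpol d a z)"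
definition Lpol where "Lpol d a z = Kpol d a z * pderiv (Fpol d a z)"

(* matrix of multiplication by P (formal degree <= k) from degree <= h to degree <= h+k *)
definition multmat :: "complex poly \<Rightarrow> nat \<Rightarrow> nat \<Rightarrow> complex mat" where
  "multmat P k h = mat (h + k + 1) (h + 1) (\<lambda>(i, j). if j \<le> i \<and> i - j \<le> k then coeff P (i - j) else 0)"

definition toprows :: "complex mat \<Rightarrow> nat \<Rightarrow> complex mat" where
  "toprows X n = mat n (dim_col X) (\<lambda>(i, j). X $$ (i, j))"
definition botrows :: "complex mat \<Rightarrow> nat \<Rightarrow> complex mat" where
  "botrows X m = mat m (dim_col X) (\<lambda>(i, j). X $$ (dim_row X - m + i, j))"

(* N : r |-> r'_p on polynomials of degree <= d-3 ; 0-based entry (i,i+1) = i+1 *)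
definition Nmat :: "nat \<Rightarrow> complex mat" where
  "Nmat d = mat (d - 2) (d - 2) (\<lambda>(i, j). if j = i + 1 then of_nat (i + 1) else 0)"

definition MF where "MF d a z = multmat (Fpol d a z) d (2 * d - 4)"
definition MFp2 where "MFp2 d a z = multmat ((pderiv (Fpol d a z))^2) (2 * d - 2) (d - 2)"
definition MLm where "MLm d a z = multmat (Lpol d a z) (2 * d - 1) (d - 3)"
definition MH where "MH d a z = multmat (Hpol d a z) (2 * d - 1) (d - 3)"

definition MFminv where "MFminv d a z = the (mat_inverse (botrows (MF d a z) (2 * d - 3)))"

definition Bmat :: "nat \<Rightarrow> (nat \<Rightarrow> pt \<Rightarrow> complex) \<Rightarrow> pt \<Rightarrow> complex mat" where
  "Bmat d a z = toprows (MFp2 d a z) d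
     - toprows (MF d a z) d * MFminv d a z * botrows (MFp2 d a z) (2 * d - 3)"

definition Emat :: "nat \<Rightarrow> (nat \<Rightarrow> pt \<Rightarrow> complex) \<Rightarrow> pt \<Rightarrow> complex mat" where
  "Emat d a z = (toprows (MH d a z) d - toprows (MLm d a z) d * Nmat d)
     - toprows (MF d a z) d * MFminv d a z
        * (botrows (MH d a z) (2 * d - 3) - botrows (MLm d a z) (2 * d - 3) * Nmat d)"

definition Ilow :: "nat \<Rightarrow> complex mat" where
  "Ilow d = mat (d - 1) (d - 2) (\<lambda>(i, j). if i = j then 1 else 0)"
definition Iup :: "nat \<Rightarrow> complex mat" where
  "Iup d = mat (d - 1) (d - 2) (\<lambda>(i, j). if i = j + 1 then 1 else 0)"

(* abelian relations (f_1..f_d), normalized to be 0 outside U and for indices outside 1..d *)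
definition AR :: "nat \<Rightarrow> (nat \<Rightarrow> pt \<Rightarrow> complex) \<Rightarrow> pt set \<Rightarrow> (nat \<Rightarrow> pt \<Rightarrow> complex) set" where
  "AR d p U = {f. (\<forall>i z. (i \<notin> {1..d} \<or> z \<notin> U) \<longrightarrow> f i z = 0)
     \<and> (\<forall>i\<in>{1..d}. holo2 U (f i))
     \<and> (\<forall>z\<in>U. (\<Sum>i=1..d. f i z) = 0)
     \<and> (\<forall>z\<in>U. (\<Sum>i=1..d. p i z * f i z) = 0)
     \<and> (\<forall>i\<in>{1..d}. \<forall>z\<in>U. dx (f i) z + dy (\<lambda>w. p i w * f i w) z = 0)}"

definition Phi :: "nat \<Rightarrow> (nat \<Rightarrow> pt \<Rightarrow> complex) \<Rightarrow> pt set \<Rightarrow> (nat \<Rightarrow> pt \<Rightarrow> complex) \<Rightarrow> (nat \<Rightarrow> pt \<Rightarrow> complex)" where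
  "Phi d p U f = (\<lambda>j z. if j \<le> d - 3 \<and> z \<in> U then
      coeff (\<Sum>i=1..d. Polynomial.smult (f i z) (\<Prod>k\<in>{1..d} - {i}. [:- p k z, 1:])) j else 0)"

definition Sol :: "nat \<Rightarrow> (nat \<Rightarrow> pt \<Rightarrow> complex) \<Rightarrow> pt set \<Rightarrow> (pt \<Rightarrow> complex mat) \<Rightarrow> (nat \<Rightarrow> pt \<Rightarrow> complex) set" where
  "Sol d a U T = {r. (\<forall>j z. (d - 3 < j \<or> z \<notin> U) \<longrightarrow> r j z = 0)
     \<and> (\<forall>j\<le>d - 3. holo2 U (r j))
     \<and> (\<forall>z\<in>U. Ilow d *\<^sub>v vec (d - 2) (\<lambda>j. dx (r j) z) + Iup d *\<^sub>v vec (d - 2) (\<lambda>j. dy (r j) z)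
              = (- (T z * Emat d a z)) *\<^sub>v vec (d - 2) (\<lambda>j. r j z))}"

end

theory Submission
  imports Defs "Jordan_Normal_Form.Determinant"
begin

text \<open>
  Eliminating the lower rows with $M^-(F)$ is Euclidean division by $F$. So $B$ represents
  $c \mapsto F_p'^2 c$ mod $F$ and $E$ represents $r \mapsto H r - L r'_p$ mod $F$.
  The function $f_i$ is recovered as $r(p_i) / F_p'(p_i)$, and
  $F_p'^2 (r'_x + p r'_y) + H r - L r'_p$ takes at the root $p_i$ the value $F_p'(p_i)^3 g_i$
  with $g_i = (f_i)'_x + (p_i f_i)'_y$.
  Let $G$ interpolate the $g_i$ in the same way as $r$ interpolates the $f_i$, and let
  $c = r'_x + p r'_y$. The two linear relations give $\sum_i g_i = 0$, so that $G$ has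
  degree at most $d-2$ and $E r = B (G - c)$ holds for every $r$. Applying $T$ shows that
  $c = -T E r$ is equivalent to $G = 0$, whichever left inverse $T$ is used.
\<close>

subsection \<open>Matrices and division by $F$\<close>

abbreviation pvec :: "nat \<Rightarrow> complex poly \<Rightarrow> complex vec" where
  "pvec n q \<equiv> vec n (coeff q)"

lemma pvec_eq_iff:
  assumes "degree q < n" "degree r < n"
  shows "pvec n q = pvec n r \<longleftrightarrow> q = r"
proof
  assume eq: "pvec n q = pvec n r"
  show "q = r"
  proof (rule poly_eqI)
    fix i
    show "coeff q i = coeff r i"
    proof (cases "i < n")
      case True
      then show ?thesis using arg_cong[OF eq, of "\<lambda>v. v $ i"] by simp
    next
      case False
      then show ?thesis using assms by (simp add: coeff_eq_0)
    qed
  qed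
qed simp

text \<open>Entry \<open>i\<close> of the product is the Cauchy convolution of the coefficients; the
  degree bounds make the cut-offs in the matrix harmless. The sizes \<open>n\<close> and
  \<open>m\<close> are tied to \<open>h\<close> and \<open>k\<close> by equations so that forms such
  as \<open>2 * d - 3\<close> can be matched.\<close>

lemma multmat_mult_pvec:
  assumes P: "degree P \<le> k" and q: "degree q \<le> h" and n: "n = h + 1" and m: "m = h + k + 1"
  shows "multmat P k h *\<^sub>v pvec n q = pvec m (P * q)"
proof (rule eq_vecI)
  fix i assume "i < dim_vec (pvec m (P * q))"
  then have i: "i < h + k + 1" using m by simp
  have "(multmat P k h *\<^sub>v pvec n q) $ i
      = (\<Sum>j<h+1. (if j \<le> i \<and> i - j \<le> k then coeff P (i - j) else 0) * coeff q j)"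
    using i n by (simp add: multmat_def scalar_prod_def lessThan_atLeast0)
  \<comment> \<open>The union of both index ranges is an intermediate stop: for \<open>j > h\<close>
    the coefficient of \<open>q\<close> vanishes, for \<open>i - j > k\<close> that of
    \<open>P\<close>, and for \<open>j > i\<close> the guard gives 0.\<close>
  also have "\<dots> = (\<Sum>j\<in>{..<h+1} \<union> {..i}. (if j \<le> i then coeff P (i - j) else 0) * coeff q j)"
    by (rule sum.mono_neutral_cong_left) (use P q in \<open>auto simp: coeff_eq_0\<close>)
  also have "\<dots> = (\<Sum>j\<le>i. coeff P (i - j) * coeff q j)"
    by (rule sum.mono_neutral_cong_right) (auto simp: coeff_eq_0)
  also have "\<dots> = coeff (q * P) i"
    by (subst coeff_mult) (simp add: mult.commute)
  finally show "(multmat P k h *\<^sub>v pvec n q) $ i = pvec m (P * q) $ i"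
    using i m by (simp add: mult.commute)
qed (use m in \<open>simp add: multmat_def\<close>)

lemma toprows_mult_vec:
  assumes "v \<in> carrier_vec (dim_col X)" "n \<le> dim_row X"
  shows "toprows X n *\<^sub>v v = vec n (\<lambda>i. (X *\<^sub>v v) $ i)"
  using assms by (intro eq_vecI) (auto simp: toprows_def scalar_prod_def)

lemma botrows_mult_vec:
  assumes "v \<in> carrier_vec (dim_col X)" "n \<le> dim_row X"
  shows "botrows X n *\<^sub>v v = vec n (\<lambda>i. (X *\<^sub>v v) $ (dim_row X - n + i))"
  using assms by (intro eq_vecI) (auto simp: botrows_def scalar_prod_def)

text \<open>The determinant is the product of the unit diagonal, so \<open>A\<close> is a unit of
  the matrix ring. Hence \<open>mat_inverse\<close> does not return \<open>None\<close>, and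
  \<open>the\<close> yields a genuine inverse.\<close>

lemma mat_inverse_upper_unitriangular:
  fixes A :: "'a :: field mat"
  assumes A: "A \<in> carrier_mat n n" and ut: "upper_triangular A"
    and diag: "\<And>i. i < n \<Longrightarrow> A $$ (i, i) = 1"
  shows "the (mat_inverse A) * A = 1\<^sub>m n" "the (mat_inverse A) \<in> carrier_mat n n"
proof -
  have "diag_mat A = replicate n 1"
    using A diag by (intro nth_equalityI) (auto simp: diag_mat_def)
  then have "det A \<noteq> 0" using det_upper_triangular[OF ut A] by simp
  then have "A \<in> Units (ring_mat TYPE('a) n undefined)"
    by (rule det_non_zero_imp_unit[OF A])
  then obtain B where "mat_inverse A = Some B"
    using mat_inverse(1)[OF A] by fastforce
  then show "the (mat_inverse A) * A = 1\<^sub>m n" "the (mat_inverse A) \<in> carrier_mat n n"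
    using mat_inverse(2)[OF A] by auto
qed

section \<open>Reduction modulo F at a fixed point\<close>

context
  fixes d :: nat and a :: "nat \<Rightarrow> pt \<Rightarrow> complex" and z :: pt
  assumes d3: "d \<ge> 3"
    and deg: "degree (Fpol d a z) = d" and lead: "coeff (Fpol d a z) d = 1"
begin

text \<open>Entry \<open>(i, j)\<close> of the bottom block is the coefficient of F of index
  \<open>d + i - j\<close> (0 for a negative index). Below the diagonal this index exceeds the
  degree \<open>d\<close>; on the diagonal stands the leading coefficient 1.\<close>

lemma MF_bottom_inverse:
  "MFminv d a z * botrows (MF d a z) (2 * d - 3) = 1\<^sub>m (2 * d - 3)"
  "MFminv d a z \<in> carrier_mat (2 * d - 3) (2 * d - 3)"
proof -
  let ?A = "botrows (MF d a z) (2 * d - 3)"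
  have A: "?A \<in> carrier_mat (2 * d - 3) (2 * d - 3)"
    using d3 by (intro carrier_matI) (simp_all add: botrows_def MF_def multmat_def)
  have "upper_triangular ?A" "\<And>i. i < 2 * d - 3 \<Longrightarrow> ?A $$ (i, i) = 1"
    using d3 lead by (auto simp: botrows_def MF_def multmat_def)
  note mat_inverse_upper_unitriangular[OF A this]
  then show "MFminv d a z * botrows (MF d a z) (2 * d - 3) = 1\<^sub>m (2 * d - 3)"
    "MFminv d a z \<in> carrier_mat (2 * d - 3) (2 * d - 3)"
    by (simp_all add: MFminv_def)
qed

text \<open>Write S = F q + R. As R has degree below \<open>d\<close>, the coefficients
  \<open>w\<close> of S from degree \<open>d\<close> on come from F q alone, so the inverse of the
  bottom block turns them into q; subtracting the top part of F q leaves R. The bound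
  \<open>3 * d - 4\<close> is what makes q fit into \<open>2 * d - 3\<close> coefficients.\<close>

lemma remainder_pvec:
  assumes degS: "degree S \<le> 3 * d - 4"
    and v: "v = pvec d S" and w: "w = vec (2 * d - 3) (\<lambda>i. coeff S (d + i))"
  shows "v - toprows (MF d a z) d *\<^sub>v (MFminv d a z *\<^sub>v w) = pvec d (S mod Fpol d a z)"
proof -
  let ?F = "Fpol d a z"
  define q where "q = S div ?F"
  define R where "R = S mod ?F"
  have S: "S = ?F * q + R" by (simp add: q_def R_def)
  have F0: "?F \<noteq> 0" using lead by auto
  have degR: "degree R < d"
    using degree_mod_less'[of ?F S] F0 deg d3 unfolding R_def
    by (cases "S mod ?F = 0") auto
  have degq: "degree q \<le> 2 * d - 4"
  proof (cases "q = 0")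
    case False
    then have "degree (?F * q) = d + degree q" using F0 deg by (simp add: degree_mult_eq)
    then have "degree S = d + degree q" using degR S
      by (simp add: degree_add_eq_left)
    then show ?thesis using degS by simp
  qed simp
  have Mq: "MF d a z *\<^sub>v pvec (2 * d - 3) q = pvec (3 * d - 3) (?F * q)"
    unfolding MF_def by (rule multmat_mult_pvec) (use d3 deg degq in auto)
  have dims: "dim_row (MF d a z) = 3 * d - 3" "dim_col (MF d a z) = 2 * d - 3"
    using d3 by (auto simp: MF_def multmat_def)
  have "botrows (MF d a z) (2 * d - 3) *\<^sub>v pvec (2 * d - 3) q = w"
    using d3 degR by (subst botrows_mult_vec) (auto simp: dims Mq w S coeff_eq_0)
  then have "MFminv d a z *\<^sub>v w
      = (MFminv d a z * botrows (MF d a z) (2 * d - 3)) *\<^sub>v pvec (2 * d - 3) q"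
    using MF_bottom_inverse(2)
    by (subst assoc_mult_mat_vec) (auto simp: botrows_def dims)
  then have "MFminv d a z *\<^sub>v w = pvec (2 * d - 3) q"
    by (simp add: MF_bottom_inverse(1))
  moreover have "toprows (MF d a z) d *\<^sub>v pvec (2 * d - 3) q = pvec d (?F * q)"
    using d3 by (subst toprows_mult_vec) (auto simp: dims Mq)
  ultimately have "v - toprows (MF d a z) d *\<^sub>v (MFminv d a z *\<^sub>v w) = pvec d S - pvec d (?F * q)"
    by (simp add: v)
  also have "\<dots> = pvec d R" by (intro eq_vecI) (auto simp: S)
  finally show ?thesis by (simp add: R_def)
qed

text \<open>The formal degrees \<open>2 * d - 2\<close> and \<open>d - 2\<close> add up to exactly
  the \<open>3 * d - 4\<close> allowed for a dividend, so the Schur complement shape of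
  \<open>Bmat\<close> becomes the formula for the remainder.\<close>

lemma Bmat_mult_pvec:
  assumes c: "degree c \<le> d - 2"
  shows "Bmat d a z *\<^sub>v pvec (d - 1) c = pvec d (((pderiv (Fpol d a z))\<^sup>2 * c) mod Fpol d a z)"
proof -
  let ?X = "MFp2 d a z" and ?P = "(pderiv (Fpol d a z))\<^sup>2"
  have degP: "degree ?P \<le> 2 * d - 2"
    using degree_power_le[of "pderiv (Fpol d a z)" 2] deg by (simp add: degree_pderiv diff_mult_distrib)
  have X: "?X *\<^sub>v pvec (d - 1) c = pvec (3 * d - 3) (?P * c)"
    unfolding MFp2_def by (rule multmat_mult_pvec) (use d3 degP c in auto)
  have dims: "dim_row ?X = 3 * d - 3" "dim_col ?X = d - 1"
      "dim_row (MF d a z) = 3 * d - 3" "dim_col (MF d a z) = 2 * d - 3"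
    using d3 by (auto simp: MF_def MFp2_def multmat_def)
  have carr: "toprows ?X d \<in> carrier_mat d (d - 1)"
     "botrows ?X (2 * d - 3) \<in> carrier_mat (2 * d - 3) (d - 1)"
     "toprows (MF d a z) d \<in> carrier_mat d (2 * d - 3)"
    using dims by (auto simp: toprows_def botrows_def)
  have "Bmat d a z *\<^sub>v pvec (d - 1) c = toprows ?X d *\<^sub>v pvec (d - 1) c
     - toprows (MF d a z) d *\<^sub>v (MFminv d a z *\<^sub>v (botrows ?X (2 * d - 3) *\<^sub>v pvec (d - 1) c))"
    unfolding Bmat_def using carr MF_bottom_inverse(2)
    by (simp add: minus_mult_distrib_mat_vec[where nr = d and nc = "d - 1"]
        assoc_mult_mat_vec[where n\<^sub>1 = d and n\<^sub>2 = "2 * d - 3" and n\<^sub>3 = "2 * d - 3"]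
        assoc_mult_mat_vec[where n\<^sub>1 = d and n\<^sub>2 = "2 * d - 3" and n\<^sub>3 = "d - 1"])
  also have "\<dots> = pvec d ((?P * c) mod Fpol d a z)"
  proof (rule remainder_pvec)
    show "degree (?P * c) \<le> 3 * d - 4"
      using degree_mult_le[of ?P c] degP c d3 by simp
    show "toprows ?X d *\<^sub>v pvec (d - 1) c = pvec d (?P * c)"
      using d3 by (subst toprows_mult_vec) (auto simp: dims X simp del: One_nat_def)
    show "botrows ?X (2 * d - 3) *\<^sub>v pvec (d - 1) c = vec (2 * d - 3) (\<lambda>i. coeff (?P * c) (d + i))"
      using d3 by (subst botrows_mult_vec) (auto simp: dims X simp del: One_nat_def)
  qed
  finally show ?thesis .
qed

lemma Nmat_mult_pvec:
  assumes "degree r \<le> d - 3"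
  shows "Nmat d *\<^sub>v pvec (d - 2) r = pvec (d - 2) (pderiv r)"
proof (rule eq_vecI)
  fix i assume "i < dim_vec (pvec (d - 2) (pderiv r))"
  then have i: "i < d - 2" by simp
  have "(Nmat d *\<^sub>v pvec (d - 2) r) $ i
      = (\<Sum>j = 0..<d - 2. if j = i + 1 then of_nat (i + 1) * coeff r j else 0)"
    using i by (simp add: Nmat_def scalar_prod_def if_distrib[where f = "\<lambda>x. x * _"] cong: if_cong)
  \<comment> \<open>In the last row, \<open>i = d - 3\<close>, the index \<open>i + 1\<close> lies
    outside the sum; there the degree bound makes the coefficient 0.\<close>
  also have "\<dots> = of_nat (i + 1) * coeff r (i + 1)"
    using assms by (simp add: coeff_eq_0)
  finally show "(Nmat d *\<^sub>v pvec (d - 2) r) $ i = pvec (d - 2) (pderiv r) $ i"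
    using i by (simp add: coeff_pderiv)
qed (simp add: Nmat_def)

text \<open>With K of degree at most \<open>d\<close>, both H and L have degree at most
  \<open>2 * d - 1\<close>, so the dividend H r - L r'_p again stays within
  \<open>3 * d - 4\<close>.\<close>

lemma Emat_mult_pvec:
  assumes K: "degree (Kpol d a z) \<le> d" and r: "degree r \<le> d - 3"
  shows "Emat d a z *\<^sub>v pvec (d - 2) r
    = pvec d ((Hpol d a z * r - Lpol d a z * pderiv r) mod Fpol d a z)"
proof -
  let ?F = "Fpol d a z" and ?K = "Kpol d a z" and ?H = "Hpol d a z" and ?L = "Lpol d a z"
  let ?XH = "MH d a z" and ?XL = "MLm d a z" and ?S = "Hpol d a z * r - Lpol d a z * pderiv r"
  have dL: "degree ?L \<le> 2 * d - 1"
    using degree_mult_le[of ?K "pderiv ?F"] K deg d3 by (simp add: Lpol_def degree_pderiv)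
  have "degree (?K * pderiv (pderiv ?F)) \<le> 2 * d - 1"
    using degree_mult_le[of ?K "pderiv (pderiv ?F)"] K deg d3 by (simp add: degree_pderiv)
  moreover have "degree (pderiv ?K * pderiv ?F) \<le> 2 * d - 1"
    using degree_mult_le[of "pderiv ?K" "pderiv ?F"] K deg d3 by (simp add: degree_pderiv)
  ultimately have dH: "degree ?H \<le> 2 * d - 1"
    unfolding Hpol_def by (rule degree_diff_le)
  have dr': "degree (pderiv r) \<le> d - 3" using r by (simp add: degree_pderiv)
  have XH: "?XH *\<^sub>v pvec (d - 2) r = pvec (3 * d - 3) (?H * r)"
    unfolding MH_def by (rule multmat_mult_pvec) (use d3 dH r in auto)
  have XL: "?XL *\<^sub>v pvec (d - 2) (pderiv r) = pvec (3 * d - 3) (?L * pderiv r)"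
    unfolding MLm_def by (rule multmat_mult_pvec) (use d3 dL dr' in auto)
  have dims: "dim_row ?XH = 3 * d - 3" "dim_col ?XH = d - 2"
      "dim_row ?XL = 3 * d - 3" "dim_col ?XL = d - 2"
      "dim_row (MF d a z) = 3 * d - 3" "dim_col (MF d a z) = 2 * d - 3"
    using d3 by (auto simp: MF_def MH_def MLm_def multmat_def)
  have carr: "toprows ?XH d \<in> carrier_mat d (d - 2)" "toprows ?XL d \<in> carrier_mat d (d - 2)"
     "botrows ?XH (2 * d - 3) \<in> carrier_mat (2 * d - 3) (d - 2)"
     "botrows ?XL (2 * d - 3) \<in> carrier_mat (2 * d - 3) (d - 2)"
     "toprows (MF d a z) d \<in> carrier_mat d (2 * d - 3)"
     "Nmat d \<in> carrier_mat (d - 2) (d - 2)"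
    using dims by (auto simp: toprows_def botrows_def Nmat_def)
  let ?T = "toprows ?XH d - toprows ?XL d * Nmat d"
  let ?B = "botrows ?XH (2 * d - 3) - botrows ?XL (2 * d - 3) * Nmat d"
  let ?v = "pvec (d - 2) r"
  have vc: "?v \<in> carrier_vec (d - 2)" by simp
  have Tv: "?T *\<^sub>v ?v = toprows ?XH d *\<^sub>v ?v - toprows ?XL d *\<^sub>v pvec (d - 2) (pderiv r)"
    using minus_mult_distrib_mat_vec[OF carr(1) mult_carrier_mat[OF carr(2,6)] vc]
      assoc_mult_mat_vec[OF carr(2,6) vc] by (simp add: Nmat_mult_pvec[OF r])
  have Bv: "?B *\<^sub>v ?v = botrows ?XH (2 * d - 3) *\<^sub>v ?v - botrows ?XL (2 * d - 3) *\<^sub>v pvec (d - 2) (pderiv r)"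
    using minus_mult_distrib_mat_vec[OF carr(3) mult_carrier_mat[OF carr(4,6)] vc]
      assoc_mult_mat_vec[OF carr(4,6) vc] by (simp add: Nmat_mult_pvec[OF r])
  have TC: "?T \<in> carrier_mat d (d - 2)" and BC: "?B \<in> carrier_mat (2 * d - 3) (d - 2)"
    using carr by (auto intro!: minus_carrier_mat)
  have C: "toprows (MF d a z) d * MFminv d a z \<in> carrier_mat d (2 * d - 3)"
    using carr(5) MF_bottom_inverse(2) by simp
  have "Emat d a z *\<^sub>v ?v = ?T *\<^sub>v ?v - (toprows (MF d a z) d * MFminv d a z * ?B) *\<^sub>v ?v"
    unfolding Emat_def by (rule minus_mult_distrib_mat_vec[OF TC mult_carrier_mat[OF C BC] vc])
  also have "(toprows (MF d a z) d * MFminv d a z * ?B) *\<^sub>v ?v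
      = toprows (MF d a z) d *\<^sub>v (MFminv d a z *\<^sub>v (?B *\<^sub>v ?v))"
    using assoc_mult_mat_vec[OF C BC vc]
      assoc_mult_mat_vec[OF carr(5) MF_bottom_inverse(2) mult_mat_vec_carrier[OF BC vc]] by simp
  also have "?T *\<^sub>v ?v - \<dots> = pvec d (?S mod ?F)"
  proof (rule remainder_pvec)
    show "degree ?S \<le> 3 * d - 4"
      using degree_mult_le[of ?H r] degree_mult_le[of ?L "pderiv r"] dH dL r dr' d3
      by (intro degree_diff_le) auto
    show "?T *\<^sub>v ?v = pvec d ?S"
      unfolding Tv using d3 by (intro eq_vecI) (auto simp: toprows_mult_vec dims XH XL)
    show "?B *\<^sub>v ?v = vec (2 * d - 3) (\<lambda>i. coeff ?S (d + i))"
      unfolding Bv using d3 by (intro eq_vecI) (auto simp: botrows_mult_vec dims XH XL)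
  qed
  finally show ?thesis .
qed

text \<open>The divisibility makes two dividends have the same remainder, which reads E r = B (G -
  c). Since \<open>G - c\<close> has degree at most \<open>d - 2\<close>, its \<open>d - 1\<close>
  coefficients determine it, and TB = Id recovers them. Thus - T E r is the vector of
  \<open>c - G\<close>.\<close>

lemma left_inverse_criterion:
  assumes K: "degree (Kpol d a z) \<le> d" and r: "degree r \<le> d - 3"
    and T: "T \<in> carrier_mat (d - 1) d" "T * Bmat d a z = 1\<^sub>m (d - 1)"
    and c: "degree c \<le> d - 2" and G: "degree G \<le> d - 2"
    and dvd: "Fpol d a z dvd
      (pderiv (Fpol d a z))\<^sup>2 * (G - c) - (Hpol d a z * r - Lpol d a z * pderiv r)"
  shows "pvec (d - 1) c = (- (T * Emat d a z)) *\<^sub>v pvec (d - 2) r \<longleftrightarrow> G = 0"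
proof -
  have B: "Bmat d a z \<in> carrier_mat d (d - 1)"
    using d3 MF_bottom_inverse(2)
    by (auto simp: Bmat_def MF_def MFp2_def multmat_def toprows_def botrows_def)
  have E: "Emat d a z \<in> carrier_mat d (d - 2)"
    using d3 MF_bottom_inverse(2)
    by (auto simp: Emat_def MF_def MH_def MLm_def multmat_def toprows_def botrows_def Nmat_def)
  have Gc: "degree (G - c) \<le> d - 2" using G c by (rule degree_diff_le)
  have v: "pvec (d - 2) r \<in> carrier_vec (d - 2)" by simp
  have "Emat d a z *\<^sub>v pvec (d - 2) r = Bmat d a z *\<^sub>v pvec (d - 1) (G - c)"
    unfolding Emat_mult_pvec[OF K r] Bmat_mult_pvec[OF Gc]
    using dvd[THEN mod_eq_dvd_iff[THEN iffD2]] by simp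
  then have "(T * Emat d a z) *\<^sub>v pvec (d - 2) r = (T * Bmat d a z) *\<^sub>v pvec (d - 1) (G - c)"
    using T(1) B E by simp
  then have "(T * Emat d a z) *\<^sub>v pvec (d - 2) r = pvec (d - 1) (G - c)"
    using T(2) by simp
  then have "(- (T * Emat d a z)) *\<^sub>v pvec (d - 2) r = pvec (d - 1) (c - G)"
    using T(1) E v by (subst uminus_mult_mat_vec) auto
  moreover have "pvec (d - 1) c = pvec (d - 1) (c - G) \<longleftrightarrow> c = c - G"
    by (rule pvec_eq_iff) (use d3 c degree_diff_le[OF c G] in auto)
  ultimately show ?thesis by auto
qed

end

text \<open>\<open>Ilow\<close> embeds degree at most \<open>d - 3\<close> into degree at most
  \<open>d - 2\<close>, and \<open>Iup\<close> multiplies by p. With the partial derivatives of r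
  for \<open>u\<close> and \<open>v\<close>, the left side of the differential system is therefore
  the vector of r'_x + p r'_y.\<close>

lemma Ilow_Iup_mult_vec:
  assumes "d \<ge> 3"
  shows "Ilow d *\<^sub>v vec (d - 2) u + Iup d *\<^sub>v vec (d - 2) v
    = pvec (d - 1) ((\<Sum>j\<le>d - 3. monom (u j) j) + [:0, 1:] * (\<Sum>j\<le>d - 3. monom (v j) j))"
  (is "?l = pvec _ (?U + ?V)")
proof (rule eq_vecI)
  fix i assume "i < dim_vec (pvec (d - 1) (?U + ?V))"
  then have i: "i < d - 1" by simp
  have "(Ilow d *\<^sub>v vec (d - 2) u) $ i = (\<Sum>j = 0..<d - 2. if j = i then u j else 0)"
    using i by (simp add: Ilow_def scalar_prod_def if_distrib[where f = "\<lambda>x. x * _"] cong: if_cong)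
  moreover have "(Iup d *\<^sub>v vec (d - 2) v) $ i
      = (\<Sum>j = 0..<d - 2. if i = j + 1 then v j else 0)"
    using i by (simp add: Iup_def scalar_prod_def if_distrib[where f = "\<lambda>x. x * _"] cong: if_cong)
  moreover have "{0..<d - 2} = {..d - 3}" using assms by auto
  ultimately show "?l $ i = pvec (d - 1) (?U + ?V) $ i"
    using i by (cases i) (auto simp: Ilow_def Iup_def coeff_sum coeff_pCons)
qed (simp add: Iup_def)

subsection \<open>Holomorphic functions of two variables\<close>

lemma holo2_const: "holo2 U (\<lambda>z. c)"
  unfolding holo2_def
proof
  fix z
  show "\<exists>\<alpha> \<beta>. ((\<lambda>z. c) has_derivative (\<lambda>w. \<alpha> * fst w + \<beta> * snd w)) (at z)"
    by (rule exI[of _ 0], rule exI[of _ 0]) simp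
qed

lemma holo2_add:
  assumes "holo2 U f" "holo2 U g"
  shows "holo2 U (\<lambda>z. f z + g z)"
  unfolding holo2_def
proof
  fix z assume "z \<in> U"
  with assms obtain \<alpha> \<beta> \<gamma> \<delta> where
    "(f has_derivative (\<lambda>w. \<alpha> * fst w + \<beta> * snd w)) (at z)"
    "(g has_derivative (\<lambda>w. \<gamma> * fst w + \<delta> * snd w)) (at z)"
    unfolding holo2_def by meson
  from has_derivative_add[OF this]
  have "((\<lambda>z. f z + g z) has_derivative (\<lambda>w. (\<alpha> + \<gamma>) * fst w + (\<beta> + \<delta>) * snd w)) (at z)"
    by (simp add: algebra_simps)
  then show "\<exists>\<alpha> \<beta>. ((\<lambda>z. f z + g z) has_derivative (\<lambda>w. \<alpha> * fst w + \<beta> * snd w)) (at z)"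
    by blast
qed

lemma holo2_mult:
  assumes "holo2 U f" "holo2 U g"
  shows "holo2 U (\<lambda>z. f z * g z)"
  unfolding holo2_def
proof
  fix z assume "z \<in> U"
  with assms obtain \<alpha> \<beta> \<gamma> \<delta> where
    "(f has_derivative (\<lambda>w. \<alpha> * fst w + \<beta> * snd w)) (at z)"
    "(g has_derivative (\<lambda>w. \<gamma> * fst w + \<delta> * snd w)) (at z)"
    unfolding holo2_def by meson
  from has_derivative_mult[OF this]
  have "((\<lambda>z. f z * g z) has_derivative
      (\<lambda>w. (f z * \<gamma> + g z * \<alpha>) * fst w + (f z * \<delta> + g z * \<beta>) * snd w)) (at z)"
    by (simp add: algebra_simps)
  then show "\<exists>\<alpha> \<beta>. ((\<lambda>z. f z * g z) has_derivative (\<lambda>w. \<alpha> * fst w + \<beta> * snd w)) (at z)"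
    by blast
qed

lemma holo2_inverse:
  assumes "holo2 U f" "\<And>z. z \<in> U \<Longrightarrow> f z \<noteq> 0"
  shows "holo2 U (\<lambda>z. inverse (f z))"
  unfolding holo2_def
proof
  fix z assume z: "z \<in> U"
  with assms obtain \<alpha> \<beta> where
    "(f has_derivative (\<lambda>w. \<alpha> * fst w + \<beta> * snd w)) (at z)"
    unfolding holo2_def by meson
  from Deriv.has_derivative_inverse[OF assms(2)[OF z] this]
  have "((\<lambda>z. inverse (f z)) has_derivative
      (\<lambda>w. (- (inverse (f z))\<^sup>2 * \<alpha>) * fst w + (- (inverse (f z))\<^sup>2 * \<beta>) * snd w)) (at z)"
    by (simp add: algebra_simps power2_eq_square)
  then show "\<exists>\<alpha> \<beta>. ((\<lambda>z. inverse (f z)) has_derivative (\<lambda>w. \<alpha> * fst w + \<beta> * snd w)) (at z)"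
    by blast
qed

lemma holo2_sum:
  assumes "\<And>i. i \<in> I \<Longrightarrow> holo2 U (f i)"
  shows "holo2 U (\<lambda>z. \<Sum>i\<in>I. f i z)"
  using assms by (induction I rule: infinite_finite_induct) (auto intro: holo2_const holo2_add)

lemma holo2_prod:
  assumes "\<And>i. i \<in> I \<Longrightarrow> holo2 U (f i)"
  shows "holo2 U (\<lambda>z. \<Prod>i\<in>I. f i z)"
  using assms by (induction I rule: infinite_finite_induct) (auto intro: holo2_const holo2_mult)

lemma holo2_uminus: "holo2 U f \<Longrightarrow> holo2 U (\<lambda>z. - f z)"
  using holo2_mult[OF holo2_const[of U "- 1"], of f] by simp

lemma holo2_diff: "holo2 U f \<Longrightarrow> holo2 U g \<Longrightarrow> holo2 U (\<lambda>z. f z - g z)"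
  using holo2_add[of U f "\<lambda>z. - g z"] holo2_uminus[of U g] by simp

lemma holo2_power: "holo2 U f \<Longrightarrow> holo2 U (\<lambda>z. f z ^ n)"
  by (induction n) (auto intro: holo2_const holo2_mult)

text \<open>Differentiability at a point of an open set sees only values inside the set. This lets
  functions cut off to 0 outside \<open>U\<close> be replaced by their formulas.\<close>

lemma holo2_cong:
  assumes f: "holo2 U f" and U: "open U" and eq: "\<And>z. z \<in> U \<Longrightarrow> g z = f z"
  shows "holo2 U g"
  unfolding holo2_def
proof
  fix z assume z: "z \<in> U"
  with f obtain \<alpha> \<beta> where "(f has_derivative (\<lambda>w. \<alpha> * fst w + \<beta> * snd w)) (at z)"
    unfolding holo2_def by meson
  then have "(g has_derivative (\<lambda>w. \<alpha> * fst w + \<beta> * snd w)) (at z)"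
    by (rule has_derivative_transform_within_open[OF _ U z]) (simp add: eq)
  then show "\<exists>\<alpha> \<beta>. (g has_derivative (\<lambda>w. \<alpha> * fst w + \<beta> * snd w)) (at z)"
    by blast
qed

lemma holo2_coeff_prod:
  assumes "\<And>i n. i \<in> I \<Longrightarrow> holo2 U (\<lambda>z. coeff (P i z) n)"
  shows "holo2 U (\<lambda>z. coeff (\<Prod>i\<in>I. P i z) n)"
  using assms
proof (induction I arbitrary: n rule: infinite_finite_induct)
  case (insert i I)
  then show ?case
    by (auto simp: coeff_mult intro!: holo2_sum holo2_mult)
qed (auto intro: holo2_const)

section \<open>Partial derivatives and implicit differentiation\<close>

lemma holo2_DERIV_fst:
  assumes "holo2 U f" "z \<in> U"
  shows "((\<lambda>t. f (t, snd z)) has_field_derivative dx f z) (at (fst z))"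
proof -
  from assms obtain \<alpha> \<beta> where "(f has_derivative (\<lambda>w. \<alpha> * fst w + \<beta> * snd w)) (at z)"
    unfolding holo2_def by meson
  then have "(f has_derivative (\<lambda>w. \<alpha> * fst w + \<beta> * snd w)) (at ((\<lambda>t. (t, snd z)) (fst z)))"
    by simp
  moreover have "((\<lambda>t. (t, snd z)) has_derivative (\<lambda>t. (t, 0))) (at (fst z))"
    by (auto intro!: derivative_eq_intros)
  ultimately have "((\<lambda>t. f (t, snd z)) has_field_derivative \<alpha>) (at (fst z))"
    unfolding has_field_derivative_def
    by (auto dest!: has_derivative_compose)
  then show ?thesis unfolding dx_def by (simp add: DERIV_imp_deriv)
qed

lemma holo2_DERIV_snd:
  assumes "holo2 U f" "z \<in> U"
  shows "((\<lambda>t. f (fst z, t)) has_field_derivative dy f z) (at (snd z))"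
proof -
  from assms obtain \<alpha> \<beta> where "(f has_derivative (\<lambda>w. \<alpha> * fst w + \<beta> * snd w)) (at z)"
    unfolding holo2_def by meson
  then have "(f has_derivative (\<lambda>w. \<alpha> * fst w + \<beta> * snd w)) (at ((\<lambda>t. (fst z, t)) (snd z)))"
    by simp
  moreover have "((\<lambda>t. (fst z, t)) has_derivative (\<lambda>t. (0, t))) (at (snd z))"
    by (auto intro!: derivative_eq_intros)
  ultimately have "((\<lambda>t. f (fst z, t)) has_field_derivative \<beta>) (at (snd z))"
    unfolding has_field_derivative_def
    by (auto dest!: has_derivative_compose)
  then show ?thesis unfolding dy_def by (simp add: DERIV_imp_deriv)
qed

text \<open>Slices of an open set by coordinate lines are open, so an identity valid on
  \<open>U\<close> may be differentiated in x or in y alone.\<close>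

lemma eventually_slice:
  assumes "open U" "z \<in> (U :: pt set)"
  shows "eventually (\<lambda>t. (t, snd z) \<in> U) (nhds (fst z))"
    and "eventually (\<lambda>t. (fst z, t) \<in> U) (nhds (snd z))"
proof -
  have "open ((\<lambda>t. (t, snd z)) -` U)" "open ((\<lambda>t. (fst z, t)) -` U)"
    using assms(1) by (auto intro!: continuous_open_vimage continuous_intros)
  then show "eventually (\<lambda>t. (t, snd z) \<in> U) (nhds (fst z))"
    and "eventually (\<lambda>t. (fst z, t) \<in> U) (nhds (snd z))"
    using assms(2) by (auto simp: eventually_nhds)
qed

text \<open>Each monomial varies through its coefficient and through its argument, which gives the
  two terms. The exponent function \<open>e\<close> covers both F, with \<open>e j = d - j\<close>,
  and r, with \<open>e j = j\<close>.\<close>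

lemma DERIV_poly_moving:
  fixes A :: "nat \<Rightarrow> complex \<Rightarrow> complex"
  assumes A: "\<And>j. j \<in> J \<Longrightarrow> (A j has_field_derivative A' j) (at t)"
    and q: "(q has_field_derivative q') (at t)"
  shows "((\<lambda>s. poly (\<Sum>j\<in>J. monom (A j s) (e j)) (q s)) has_field_derivative
    poly (\<Sum>j\<in>J. monom (A' j) (e j)) (q t)
      + poly (pderiv (\<Sum>j\<in>J. monom (A j t) (e j))) (q t) * q') (at t)"
proof -
  have "((\<lambda>s. \<Sum>j\<in>J. A j s * q s ^ e j) has_field_derivative
      (\<Sum>j\<in>J. A' j * q t ^ e j + A j t * (of_nat (e j) * q t ^ (e j - 1) * q'))) (at t)"
    by (rule DERIV_sum) (auto intro!: derivative_eq_intros A q)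
  then show ?thesis
    by (simp add: poly_sum poly_monom pderiv_monom higher_pderiv_sum[of 1, simplified] sum.distrib sum_distrib_left
        mult_ac cong: sum.cong)
qed

text \<open>The hypotheses \<open>x\<close> and \<open>y\<close> come from differentiating F(p_i) =
  0, and \<open>fx\<close> and \<open>fy\<close> from differentiating f_i F'_p(p_i) = r(p_i).
  Solving for the values of \<open>Px\<close>, \<open>Py\<close>, \<open>Rx\<close>,
  \<open>Ry\<close> at \<open>q\<close> and substituting cancels all terms in the p-derivatives of
  \<open>Px\<close>, \<open>Py\<close>, \<open>R\<close> and in P''. The summand \<open>Py\<close>
  of K'_p survives and contributes \<open>qy * f\<close>, the term that completes q f'_y to (q
  f)'_y.\<close>

lemma implicit_pde_eq:
  fixes P Px Py R Rx Ry :: "complex poly"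
  defines "K \<equiv> Px + [:0, 1:] * Py"
  assumes x: "poly Px q + poly (pderiv P) q * qx = 0"
    and y: "poly Py q + poly (pderiv P) q * qy = 0"
    and f: "f * poly (pderiv P) q = poly R q"
    and fx: "fx * poly (pderiv P) q + f * (poly (pderiv Px) q + poly (pderiv (pderiv P)) q * qx)
      = poly Rx q + poly (pderiv R) q * qx"
    and fy: "fy * poly (pderiv P) q + f * (poly (pderiv Py) q + poly (pderiv (pderiv P)) q * qy)
      = poly Ry q + poly (pderiv R) q * qy"
  shows "poly ((pderiv P)\<^sup>2 * (Rx + [:0, 1:] * Ry)
      + ((K * pderiv (pderiv P) - pderiv K * pderiv P) * R - K * pderiv P * pderiv R)) q
    = (poly (pderiv P) q) ^ 3 * (fx + (qy * f + q * fy))"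
proof -
  have Px: "poly Px q = - poly (pderiv P) q * qx" and Py: "poly Py q = - poly (pderiv P) q * qy"
    using x y by (simp_all add: add_eq_0_iff)
  have Rx: "poly Rx q = fx * poly (pderiv P) q
      + f * (poly (pderiv Px) q + poly (pderiv (pderiv P)) q * qx) - poly (pderiv R) q * qx"
    and Ry: "poly Ry q = fy * poly (pderiv P) q
      + f * (poly (pderiv Py) q + poly (pderiv (pderiv P)) q * qy) - poly (pderiv R) q * qy"
    using fx fy by (simp_all add: algebra_simps)
  \<comment> \<open>A ring identity in free scalars: \<open>D\<close>, \<open>D2\<close>,
    \<open>u\<close>, \<open>v\<close>, \<open>R'\<close> stand for the values at \<open>q\<close>
    of P', P'' and the p-derivatives of \<open>Px\<close>, \<open>Py\<close>,
    \<open>R\<close>.\<close>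
  have "D\<^sup>2 * (fx * D + f * (u + D2 * qx) - R' * qx + q * (fy * D + f * (v + D2 * qy) - R' * qy))
      + (((- D * qx + q * (- D * qy)) * D2 - (u + (q * v + - D * qy)) * D) * (f * D)
         - (- D * qx + q * (- D * qy)) * D * R')
    = D ^ 3 * (fx + (qy * f + q * fy))" for D D2 u v R' :: complex
    by (simp add: algebra_simps power2_eq_square power3_eq_cube)
  from this[of "poly (pderiv P) q" "poly (pderiv Px) q" "poly (pderiv (pderiv P)) q"
      "poly (pderiv R) q" "poly (pderiv Py) q"]
  show ?thesis
    unfolding K_def by (simp add: pderiv_add pderiv_mult pderiv_pCons Px Py Rx Ry f[symmetric])
qed

text \<open>Puts the derivative back into the form required by \<open>DERIV_poly_moving\<close>. For
  \<open>e j = 0\<close> the truncated exponent is harmless because the factor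
  \<open>of_nat (e j)\<close> vanishes.\<close>

lemma pderiv_sum_monom:
  "pderiv (\<Sum>j\<in>J. monom (A j) (e j)) = (\<Sum>j\<in>J. monom (of_nat (e j) * A j) (e j - 1))"
  using higher_pderiv_sum[of 1 "\<lambda>j. monom (A j) (e j)" J] by (simp add: pderiv_monom)

text \<open>On a coordinate slice, \<open>P\<close> is F, \<open>q\<close> a root and
  \<open>R\<close> the polynomial r. Both identities hold near \<open>t\<close>, so uniqueness of
  the derivative equates the derivatives of their two sides; the results are the inputs of
  \<open>implicit_pde_eq\<close>.\<close>

lemma implicit_derivatives:
  fixes A B :: "nat \<Rightarrow> complex \<Rightarrow> complex" and I J :: "nat set" and e h :: "nat \<Rightarrow> nat"
  defines "P \<equiv> \<lambda>s. \<Sum>j\<in>I. monom (A j s) (e j)" and "R \<equiv> \<lambda>s. \<Sum>j\<in>J. monom (B j s) (h j)"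
  assumes A: "\<And>j. j \<in> I \<Longrightarrow> (A j has_field_derivative A' j) (at t)"
    and B: "\<And>j. j \<in> J \<Longrightarrow> (B j has_field_derivative B' j) (at t)"
    and q: "(q has_field_derivative q') (at t)" and f: "(f has_field_derivative f') (at t)"
    and root: "eventually (\<lambda>s. poly (P s) (q s) = 0) (nhds t)"
    and residue: "eventually (\<lambda>s. f s * poly (pderiv (P s)) (q s) = poly (R s) (q s)) (nhds t)"
  shows "poly (\<Sum>j\<in>I. monom (A' j) (e j)) (q t) + poly (pderiv (P t)) (q t) * q' = 0"
    and "f' * poly (pderiv (P t)) (q t)
        + f t * (poly (pderiv (\<Sum>j\<in>I. monom (A' j) (e j))) (q t)
          + poly (pderiv (pderiv (P t))) (q t) * q')
      = poly (\<Sum>j\<in>J. monom (B' j) (h j)) (q t) + poly (pderiv (R t)) (q t) * q'"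
proof -
  have "((\<lambda>s. poly (P s) (q s)) has_field_derivative
      poly (\<Sum>j\<in>I. monom (A' j) (e j)) (q t) + poly (pderiv (P t)) (q t) * q') (at t)"
    unfolding P_def using A q by (rule DERIV_poly_moving[where J = I and A = A and A' = A'])
  moreover have "((\<lambda>s. poly (P s) (q s)) has_field_derivative 0) (at t)"
    using DERIV_cong_ev[OF refl root refl, of 0] by simp
  ultimately show "poly (\<Sum>j\<in>I. monom (A' j) (e j)) (q t) + poly (pderiv (P t)) (q t) * q' = 0"
    by (rule DERIV_unique)
  have "((\<lambda>s. poly (pderiv (P s)) (q s)) has_field_derivative
      poly (pderiv (\<Sum>j\<in>I. monom (A' j) (e j))) (q t)
        + poly (pderiv (pderiv (P t))) (q t) * q') (at t)"
    unfolding P_def pderiv_sum_monom[of _ e I]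
    by (rule DERIV_poly_moving[where A = "\<lambda>j s. of_nat (e j) * A j s"
          and A' = "\<lambda>j. of_nat (e j) * A' j"]) (use A q in \<open>auto intro: DERIV_cmult\<close>)
  from DERIV_mult'[OF f this]
  have "((\<lambda>s. f s * poly (pderiv (P s)) (q s)) has_field_derivative
      f' * poly (pderiv (P t)) (q t)
        + f t * (poly (pderiv (\<Sum>j\<in>I. monom (A' j) (e j))) (q t)
          + poly (pderiv (pderiv (P t))) (q t) * q')) (at t)"
    by (simp add: add.commute)
  moreover have "((\<lambda>s. poly (R s) (q s)) has_field_derivative
      poly (\<Sum>j\<in>J. monom (B' j) (h j)) (q t) + poly (pderiv (R t)) (q t) * q') (at t)"
    unfolding R_def using B q by (rule DERIV_poly_moving[where J = J and A = B and A' = B'])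
  then have "((\<lambda>s. f s * poly (pderiv (P s)) (q s)) has_field_derivative
      poly (\<Sum>j\<in>J. monom (B' j) (h j)) (q t) + poly (pderiv (R t)) (q t) * q') (at t)"
    by (subst DERIV_cong_ev[OF refl residue refl])
  ultimately show "f' * poly (pderiv (P t)) (q t)
        + f t * (poly (pderiv (\<Sum>j\<in>I. monom (A' j) (e j))) (q t)
          + poly (pderiv (pderiv (P t))) (q t) * q')
      = poly (\<Sum>j\<in>J. monom (B' j) (h j)) (q t) + poly (pderiv (R t)) (q t) * q'"
    by (rule DERIV_unique)
qed

lemma partials_of_constant:
  assumes "open U" "z \<in> U" "\<And>w. w \<in> U \<Longrightarrow> f w = c"
  shows "dx f z = 0" "dy f z = 0"
proof -
  have "deriv (\<lambda>t. f (t, snd z)) (fst z) = deriv (\<lambda>t. c) (fst z)"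
    using eventually_slice(1)[OF assms(1,2)]
    by (intro deriv_cong_ev refl) (auto elim!: eventually_mono simp: assms(3))
  then show "dx f z = 0" by (simp add: dx_def)
  have "deriv (\<lambda>t. f (fst z, t)) (snd z) = deriv (\<lambda>t. c) (snd z)"
    using eventually_slice(2)[OF assms(1,2)]
    by (intro deriv_cong_ev refl) (auto elim!: eventually_mono simp: assms(3))
  then show "dy f z = 0" by (simp add: dy_def)
qed

lemma dx_sum:
  assumes "\<And>i. i \<in> I \<Longrightarrow> holo2 U (f i)" "z \<in> U"
  shows "dx (\<lambda>w. \<Sum>i\<in>I. f i w) z = (\<Sum>i\<in>I. dx (f i) z)"
  unfolding dx_def[of "\<lambda>w. \<Sum>i\<in>I. f i w"]
  by (intro DERIV_imp_deriv DERIV_sum holo2_DERIV_fst[where U = U] assms)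

lemma dy_sum:
  assumes "\<And>i. i \<in> I \<Longrightarrow> holo2 U (f i)" "z \<in> U"
  shows "dy (\<lambda>w. \<Sum>i\<in>I. f i w) z = (\<Sum>i\<in>I. dy (f i) z)"
  unfolding dy_def[of "\<lambda>w. \<Sum>i\<in>I. f i w"]
  by (intro DERIV_imp_deriv DERIV_sum holo2_DERIV_snd[where U = U] assms)

lemma dy_mult:
  assumes "holo2 U f" "holo2 U g" "z \<in> U"
  shows "dy (\<lambda>w. f w * g w) z = dy f z * g z + f z * dy g z"
  using DERIV_mult'[OF holo2_DERIV_snd[OF assms(1,3)] holo2_DERIV_snd[OF assms(2,3)]]
  unfolding dy_def[of "\<lambda>w. f w * g w"] by (simp add: DERIV_imp_deriv)

subsection \<open>Lagrange interpolation\<close>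

text \<open>The numerator of the sum of c_i / (p - q_i) over the common denominator:
  \<open>c\<close> lists residues rather than values at the nodes, which avoids division.\<close>

definition lagrange :: "nat set \<Rightarrow> (nat \<Rightarrow> complex) \<Rightarrow> (nat \<Rightarrow> complex) \<Rightarrow> complex poly" where
  "lagrange I q c = (\<Sum>i\<in>I. Polynomial.smult (c i) (\<Prod>k\<in>I - {i}. [:- q k, 1:]))"

lemma monic_prod_linear:
  assumes "finite I"
  shows "degree (\<Prod>k\<in>I. [:- q k, 1 :: complex:]) = card I"
    and "coeff (\<Prod>k\<in>I. [:- q k, 1 :: complex:]) (card I) = 1"
proof -
  show deg: "degree (\<Prod>k\<in>I. [:- q k, 1 :: complex:]) = card I"
    by (subst degree_prod_eq_sum_degree) auto
  show "coeff (\<Prod>k\<in>I. [:- q k, 1 :: complex:]) (card I) = 1"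
    using lead_coeff_prod[of "\<lambda>k. [:- q k, 1:]" I] unfolding deg by simp
qed

lemma poly_lagrange_node:
  assumes "finite I" "i \<in> I"
  shows "poly (lagrange I q c) (q i) = c i * (\<Prod>k\<in>I - {i}. q i - q k)"
proof -
  have "poly (lagrange I q c) (q i) = (\<Sum>j\<in>I. c j * (\<Prod>k\<in>I - {j}. q i - q k))"
    by (simp add: lagrange_def poly_sum poly_prod)
  also have "\<dots> = c i * (\<Prod>k\<in>I - {i}. q i - q k) + (\<Sum>j\<in>I - {i}. c j * (\<Prod>k\<in>I - {j}. q i - q k))"
    using assms by (rule sum.remove)
  also have "(\<Sum>j\<in>I - {i}. c j * (\<Prod>k\<in>I - {j}. q i - q k)) = 0"
    using assms by (intro sum.neutral) auto
  finally show ?thesis by simp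
qed

lemma degree_lagrange: "finite I \<Longrightarrow> degree (lagrange I q c) \<le> card I - 1"
  unfolding lagrange_def
  by (intro degree_sum_le order_trans[OF degree_smult_le]) (auto simp: monic_prod_linear)

lemma coeff_lagrange_top:
  assumes "finite I"
  shows "coeff (lagrange I q c) (card I - 1) = (\<Sum>i\<in>I. c i)"
  unfolding lagrange_def coeff_sum
proof (rule sum.cong[OF refl])
  fix i assume "i \<in> I"
  then show "coeff (Polynomial.smult (c i) (\<Prod>k\<in>I - {i}. [:- q k, 1:])) (card I - 1) = c i"
    using monic_prod_linear(2)[of "I - {i}" q] assms by simp
qed

text \<open>Partial fractions: p / (p - q_i) = q_i / (p - q_i) + 1, multiplied by c_i and by the
  full product, then summed.\<close>

lemma lagrange_shift:
  assumes "finite I"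
  shows "[:0, 1:] * lagrange I q c
    = lagrange I q (\<lambda>i. q i * c i) + Polynomial.smult (\<Sum>i\<in>I. c i) (\<Prod>i\<in>I. [:- q i, 1:])"
proof -
  have "[:0, 1:] * Polynomial.smult (c i) (\<Prod>k\<in>I - {i}. [:- q k, 1:])
      = Polynomial.smult (q i * c i) (\<Prod>k\<in>I - {i}. [:- q k, 1:])
        + Polynomial.smult (c i) (\<Prod>k\<in>I. [:- q k, 1:])" if "i \<in> I" for i
  proof -
    define G where "G = (\<Prod>k\<in>I - {i}. [:- q k, 1:])"
    have P: "(\<Prod>k\<in>I. [:- q k, 1:]) = [:- q i, 1:] * G"
      unfolding G_def by (rule prod.remove[OF assms that])
    show ?thesis
      unfolding G_def[symmetric] P
      by (intro poly_eqI) (simp add: coeff_pCons algebra_simps split: nat.split)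
  qed
  then have "[:0, 1:] * lagrange I q c = (\<Sum>i\<in>I. Polynomial.smult (q i * c i) (\<Prod>k\<in>I - {i}. [:- q k, 1:])
        + Polynomial.smult (c i) (\<Prod>k\<in>I. [:- q k, 1:]))"
    unfolding lagrange_def sum_distrib_left by (intro sum.cong refl)
  then show ?thesis
    by (simp only: lagrange_def sum.distrib smult_sum)
qed

text \<open>When the c_i sum to 0, multiplying by p merely replaces c_i by q_i c_i, and the
  coefficient sought becomes the top one of the shifted interpolant.\<close>

lemma coeff_lagrange_subtop:
  assumes "finite I" "card I \<ge> 2" "(\<Sum>i\<in>I. c i) = 0"
  shows "coeff (lagrange I q c) (card I - 2) = (\<Sum>i\<in>I. q i * c i)"
proof -
  have "card I - 1 = Suc (card I - 2)" using assms(2) by simp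
  then have "coeff (lagrange I q c) (card I - 2) = coeff ([:0, 1:] * lagrange I q c) (card I - 1)"
    by simp
  also have "\<dots> = (\<Sum>i\<in>I. q i * c i)"
    unfolding lagrange_shift[OF assms(1)] using assms(3)
    by (simp add: coeff_lagrange_top[OF assms(1)] del: One_nat_def)
  finally show ?thesis .
qed

lemma lagrange_unique:
  assumes "finite I" "inj_on q I" "degree R < card I"
    and "\<And>i. i \<in> I \<Longrightarrow> poly R (q i) = c i * (\<Prod>k\<in>I - {i}. q i - q k)"
  shows "R = lagrange I q c"
proof (rule poly_eqI_degree[where A = "q ` I"])
  show "degree (lagrange I q c) < card (q ` I)"
    using assms(1-3) degree_lagrange[of I q c] by (simp add: card_image)
qed (use assms in \<open>auto simp: card_image poly_lagrange_node\<close>)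

subsection \<open>The web\<close>

context
  fixes d :: nat and U :: "pt set" and a p :: "nat \<Rightarrow> pt \<Rightarrow> complex"
  assumes d3: "d \<ge> 3" and U: "open U"
    and a0: "\<forall>z\<in>U. a 0 z = 1"
    and a_holo: "\<forall>i\<in>{1..d}. holo2 U (a i)"
    and p_holo: "\<forall>i\<in>{1..d}. holo2 U (p i)"
    and factored: "\<forall>z\<in>U. \<forall>t. (\<Sum>i\<le>d. a i z * t ^ (d - i)) = (\<Prod>i=1..d. t - p i z)"
    and distinct: "\<forall>z\<in>U. \<forall>i\<in>{1..d}. \<forall>j\<in>{1..d}. i \<noteq> j \<longrightarrow> p i z \<noteq> p j z"
begin

section \<open>The polynomial F and its roots\<close>

lemma a_holo_le: "i \<le> d \<Longrightarrow> holo2 U (a i)"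
  using a_holo holo2_cong[OF holo2_const U, of "a 0" 1] a0 by (cases i) auto

lemma coeff_Fpol_lead: "z \<in> U \<Longrightarrow> coeff (Fpol d a z) d = 1"
proof -
  assume z: "z \<in> U"
  have "coeff (Fpol d a z) d = (\<Sum>i\<le>d. if i = 0 then a i z else 0)"
    unfolding Fpol_def coeff_sum using d3 by (intro sum.cong) auto
  then show ?thesis using a0 z by simp
qed

lemma degree_Fpol:
  assumes "z \<in> U"
  shows "degree (Fpol d a z) = d"
proof (rule antisym)
  show "degree (Fpol d a z) \<le> d"
    unfolding Fpol_def by (intro degree_sum_le order_trans[OF degree_monom_le]) auto
  show "d \<le> degree (Fpol d a z)"
    using coeff_Fpol_lead[OF assms] by (intro le_degree) simp
qed

text \<open>Since \<open>a 0\<close> is constant on \<open>U\<close>, F'_x and F'_y have degree at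
  most \<open>d - 1\<close>, and the factor p raises F'_y only to \<open>d\<close>. This is the
  bound behind the formal degree \<open>2 * d - 1\<close> of H and L.\<close>

lemma degree_Kpol:
  assumes z: "z \<in> U"
  shows "degree (Kpol d a z) \<le> d"
proof -
  have zero: "dx (a 0) z = 0" "dy (a 0) z = 0"
    using partials_of_constant[OF U z, of "a 0" 1] a0 by auto
  have "degree (Fxpol d a z) \<le> d - 1" "degree (Fypol d a z) \<le> d - 1"
    unfolding Fxpol_def Fypol_def
    by (intro degree_sum_le; (simp; fail)?; rename_tac i; case_tac "i = 0";
        simp add: zero order_trans[OF degree_monom_le])+
  then show ?thesis
    unfolding Kpol_def using d3 degree_mult_le[of "[:0, 1:]" "Fypol d a z"]
    by (intro degree_add_le) auto
qed

lemma poly_Fpol: "z \<in> U \<Longrightarrow> poly (Fpol d a z) t = (\<Prod>i=1..d. t - p i z)"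
  using factored by (simp add: Fpol_def poly_sum poly_monom)

text \<open>In the product rule only the term that differentiates the factor p - p_i survives at
  p_i. The value is the factor in \<open>poly_lagrange_node\<close>, so the interpolant of the f_i
  equals f_i F'_p(p_i) at p_i.\<close>

lemma poly_pderiv_Fpol_root:
  assumes z: "z \<in> U" and i: "i \<in> {1..d}"
  shows "poly (pderiv (Fpol d a z)) (p i z) = (\<Prod>k\<in>{1..d} - {i}. p i z - p k z)"
proof -
  have "Fpol d a z = (\<Prod>k\<in>{1..d}. [:- p k z, 1:])"
    by (rule poly_ext) (simp add: poly_Fpol[OF z] poly_prod)
  also have "\<dots> = [:- p i z, 1:] * (\<Prod>k\<in>{1..d} - {i}. [:- p k z, 1:])"
    using i by (intro prod.remove) auto
  finally show ?thesis
    by (simp only: pderiv_mult poly_add poly_mult) (simp add: poly_prod pderiv_pCons)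
qed

lemma poly_pderiv_Fpol_root_nonzero:
  assumes "z \<in> U" "i \<in> {1..d}"
  shows "poly (pderiv (Fpol d a z)) (p i z) \<noteq> 0"
  using assms distinct by (auto simp: poly_pderiv_Fpol_root)

lemma inj_on_roots: "z \<in> U \<Longrightarrow> inj_on (\<lambda>i. p i z) {1..d}"
  using distinct by (auto simp: inj_on_def)

text \<open>The remainder modulo F has degree below \<open>d\<close> and vanishes at
  \<open>d\<close> distinct roots, hence is 0.\<close>

lemma Fpol_dvdI:
  assumes z: "z \<in> U" and zero: "\<And>i. i \<in> {1..d} \<Longrightarrow> poly S (p i z) = 0"
  shows "Fpol d a z dvd S"
proof -
  let ?F = "Fpol d a z"
  have "?F \<noteq> 0" using degree_Fpol[OF z] d3 by auto
  then have deg: "degree (S mod ?F) < d"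
    using degree_mod_less'[of ?F S] degree_Fpol[OF z] d3 by (cases "S mod ?F = 0") auto
  have "S mod ?F = 0"
  proof (rule poly_eqI_degree[where A = "(\<lambda>i. p i z) ` {1..d}"])
    fix x assume "x \<in> (\<lambda>i. p i z) ` {1..d}"
    then obtain i where i: "i \<in> {1..d}" "x = p i z" by blast
    have "poly ?F x = 0" unfolding poly_Fpol[OF z] i(2) using i(1) by (intro prod_zero) auto
    moreover have "poly S x = poly (S div ?F * ?F + S mod ?F) x" by simp
    ultimately show "poly (S mod ?F) x = poly 0 x" using zero[OF i(1)] i(2)
      by (simp only: poly_add poly_mult) simp
  qed (use deg inj_on_roots[OF z] d3 in \<open>auto simp: card_image\<close>)
  then show ?thesis by (rule mod_0_imp_dvd)
qed

text \<open>Serves both directions of the bijection. The links between \<open>r\<close> and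
  \<open>f\<close> are assumed on all of \<open>U\<close> because they get differentiated; the
  equivalence itself is pointwise and passes through \<open>G = 0\<close> by
  \<open>left_inverse_criterion\<close>.\<close>

lemma web_equation_iff:
  fixes r f :: "nat \<Rightarrow> pt \<Rightarrow> complex"
  assumes r_holo: "\<And>j. j \<le> d - 3 \<Longrightarrow> holo2 U (r j)"
    and f_holo: "\<And>i. i \<in> {1..d} \<Longrightarrow> holo2 U (f i)"
    and interpolant: "\<And>w. w \<in> U \<Longrightarrow> (\<Sum>j\<le>d - 3. monom (r j w) j)
      = lagrange {1..d} (\<lambda>i. p i w) (\<lambda>i. f i w)"
    and sum0: "\<And>w. w \<in> U \<Longrightarrow> (\<Sum>i=1..d. f i w) = 0"
    and sum1: "\<And>w. w \<in> U \<Longrightarrow> (\<Sum>i=1..d. p i w * f i w) = 0"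
    and z: "z \<in> U" and T: "T \<in> carrier_mat (d - 1) d" "T * Bmat d a z = 1\<^sub>m (d - 1)"
  shows "Ilow d *\<^sub>v vec (d - 2) (\<lambda>j. dx (r j) z) + Iup d *\<^sub>v vec (d - 2) (\<lambda>j. dy (r j) z)
        = (- (T * Emat d a z)) *\<^sub>v vec (d - 2) (\<lambda>j. r j z)
    \<longleftrightarrow> (\<forall>i\<in>{1..d}. dx (f i) z + dy (\<lambda>w. p i w * f i w) z = 0)"
proof -
  let ?F = "Fpol d a z" and ?q = "\<lambda>i. p i z"
  define R Rx Ry where "R = (\<Sum>j\<le>d - 3. monom (r j z) j)"
    and "Rx = (\<Sum>j\<le>d - 3. monom (dx (r j) z) j)" and "Ry = (\<Sum>j\<le>d - 3. monom (dy (r j) z) j)"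
  define g where "g = (\<lambda>i. dx (f i) z + dy (\<lambda>w. p i w * f i w) z)"
  define G where "G = lagrange {1..d} ?q g"
  define c where "c = Rx + [:0, 1:] * Ry"
  have degrees: "degree R \<le> d - 3" "degree Rx \<le> d - 3" "degree Ry \<le> d - 3"
    unfolding R_def Rx_def Ry_def by (auto intro!: degree_sum_le order_trans[OF degree_monom_le])
  have c_deg: "degree c \<le> d - 2"
    unfolding c_def using degrees d3 degree_mult_le[of "[:0, 1:]" Ry]
    by (intro degree_add_le) auto
  have pf_holo: "holo2 U (\<lambda>w. p i w * f i w)" if "i \<in> {1..d}" for i
    using p_holo f_holo that by (auto intro: holo2_mult)

  \<comment> \<open>The sum of the g_i is the x-derivative of the first linear relation plus the
    y-derivative of the second. So it vanishes even before any single g_i is known to, and the top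
    coefficient of \<open>G\<close> drops out.\<close>
  have "(\<Sum>i=1..d. g i) = dx (\<lambda>w. \<Sum>i=1..d. f i w) z + dy (\<lambda>w. \<Sum>i=1..d. p i w * f i w) z"
    unfolding g_def sum.distrib using f_holo pf_holo z
    by (subst dx_sum[where U = U], blast, blast, subst dy_sum[where U = U], blast, blast) simp
  also have "\<dots> = 0"
    using partials_of_constant(1)[OF U z sum0] partials_of_constant(2)[OF U z sum1] by simp
  finally have G_top: "coeff G (d - 1) = 0"
    unfolding G_def using coeff_lagrange_top[of "{1..d}" ?q g] by simp
  have G_deg: "degree G \<le> d - 2"
  proof (rule degree_le, intro allI impI)
    fix n assume n: "d - 2 < n"
    show "coeff G n = 0"
    proof (cases "n = d - 1")
      case False
      then show ?thesis
        using n degree_lagrange[of "{1..d}" ?q g] d3 unfolding G_def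
        by (intro coeff_eq_0) auto
    qed (use G_top in simp)
  qed

  have root: "poly (Fpol d a w) (p i w) = 0" if "w \<in> U" "i \<in> {1..d}" for w i
    unfolding poly_Fpol[OF that(1)] using that(2) by (intro prod_zero) auto
  have residue: "f i w * poly (pderiv (Fpol d a w)) (p i w) = poly (\<Sum>j\<le>d - 3. monom (r j w) j) (p i w)"
    if "w \<in> U" "i \<in> {1..d}" for w i
    using poly_lagrange_node[of "{1..d}" i "\<lambda>i. p i w"] that
    by (simp add: interpolant poly_pderiv_Fpol_root)

  have G_node: "poly G (?q i) = g i * poly (pderiv ?F) (?q i)" if i: "i \<in> {1..d}" for i
    using poly_lagrange_node[OF _ i, of ?q g] poly_pderiv_Fpol_root[OF z i] by (simp add: G_def)
  \<comment> \<open>This is \<open>implicit_pde_eq\<close> at the root p_i, with its inputs obtained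
    by implicit differentiation along the two coordinate slices through \<open>z\<close>.\<close>
  have transport: "poly ((pderiv ?F)\<^sup>2 * c + (Hpol d a z * R - Lpol d a z * pderiv R)) (?q i)
      = (poly (pderiv ?F) (?q i)) ^ 3 * g i" if i: "i \<in> {1..d}" for i
  proof -
    have pi: "holo2 U (p i)" using p_holo i by blast
    note slice = eventually_slice[OF U z]
    have x: "eventually (\<lambda>t. poly (\<Sum>j\<le>d. monom (a j (t, snd z)) (d - j)) (p i (t, snd z)) = 0) (nhds (fst z))"
      "eventually (\<lambda>t. f i (t, snd z)
        * poly (pderiv (\<Sum>j\<le>d. monom (a j (t, snd z)) (d - j))) (p i (t, snd z))
        = poly (\<Sum>j\<le>d - 3. monom (r j (t, snd z)) j) (p i (t, snd z))) (nhds (fst z))"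
      using slice(1) by (rule eventually_mono; use root[OF _ i] residue[OF _ i] in \<open>simp add: Fpol_def\<close>)+
    have y: "eventually (\<lambda>t. poly (\<Sum>j\<le>d. monom (a j (fst z, t)) (d - j)) (p i (fst z, t)) = 0) (nhds (snd z))"
      "eventually (\<lambda>t. f i (fst z, t)
        * poly (pderiv (\<Sum>j\<le>d. monom (a j (fst z, t)) (d - j))) (p i (fst z, t))
        = poly (\<Sum>j\<le>d - 3. monom (r j (fst z, t)) j) (p i (fst z, t))) (nhds (snd z))"
      using slice(2) by (rule eventually_mono; use root[OF _ i] residue[OF _ i] in \<open>simp add: Fpol_def\<close>)+
    note X = implicit_derivatives[where I = "{..d}" and J = "{..d - 3}" and e = "\<lambda>j. d - j" and h = "\<lambda>j. j"
        and A = "\<lambda>j t. a j (t, snd z)" and A' = "\<lambda>j. dx (a j) z"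
        and B = "\<lambda>j t. r j (t, snd z)" and B' = "\<lambda>j. dx (r j) z",
        OF holo2_DERIV_fst[OF a_holo_le z] holo2_DERIV_fst[OF r_holo z]
          holo2_DERIV_fst[OF pi z] holo2_DERIV_fst[OF f_holo[OF i] z] x, simplified]
    note Y = implicit_derivatives[where I = "{..d}" and J = "{..d - 3}" and e = "\<lambda>j. d - j" and h = "\<lambda>j. j"
        and A = "\<lambda>j t. a j (fst z, t)" and A' = "\<lambda>j. dy (a j) z"
        and B = "\<lambda>j t. r j (fst z, t)" and B' = "\<lambda>j. dy (r j) z",
        OF holo2_DERIV_snd[OF a_holo_le z] holo2_DERIV_snd[OF r_holo z]
          holo2_DERIV_snd[OF pi z] holo2_DERIV_snd[OF f_holo[OF i] z] y, simplified]
    note folds = Fpol_def[symmetric] Fxpol_def[symmetric] Fypol_def[symmetric]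
      R_def[symmetric] Rx_def[symmetric] Ry_def[symmetric]
    have "g i = dx (f i) z + (dy (p i) z * f i z + p i z * dy (f i) z)"
      unfolding g_def by (simp add: dy_mult[OF pi f_holo[OF i] z])
    moreover have "f i z * poly (pderiv ?F) (?q i) = poly R (?q i)"
      using residue[OF z i] by (simp add: R_def)
    ultimately show ?thesis
      using implicit_pde_eq[OF X(1)[unfolded folds] Y(1)[unfolded folds] _
          X(2)[unfolded folds] Y(2)[unfolded folds]]
      by (simp only: c_def Hpol_def Lpol_def Kpol_def)
  qed
  \<comment> \<open>As G(p_i) = g_i F'_p(p_i), the polynomial F'_p^2 G also takes the value
    F'_p(p_i)^3 g_i at p_i; together with \<open>transport\<close> the difference vanishes at every
    root.\<close>
  have "?F dvd (pderiv ?F)\<^sup>2 * (G - c) - (Hpol d a z * R - Lpol d a z * pderiv R)"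
  proof (rule Fpol_dvdI[OF z])
    fix i assume i: "i \<in> {1..d}"
    show "poly ((pderiv ?F)\<^sup>2 * (G - c) - (Hpol d a z * R - Lpol d a z * pderiv R)) (?q i) = 0"
      using transport[OF i] G_node[OF i]
      by (simp add: algebra_simps power2_eq_square power3_eq_cube)
  qed
  note left_inverse_criterion[OF d3 degree_Fpol[OF z] coeff_Fpol_lead[OF z] degree_Kpol[OF z]
      degrees(1) T c_deg G_deg this]
  moreover have "G = 0 \<longleftrightarrow> (\<forall>i\<in>{1..d}. g i = 0)"
  proof
    assume "G = 0"
    \<comment> \<open>Distinctness of the roots enters here: F'_p(p_i) is nonzero, so G(p_i) = 0
      forces g_i = 0.\<close>
    then show "\<forall>i\<in>{1..d}. g i = 0"
      using G_node poly_pderiv_Fpol_root_nonzero[OF z] by simp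
  qed (simp add: G_def lagrange_def)
  moreover have "vec (d - 2) (\<lambda>j. r j z) = pvec (d - 2) R"
    using d3 by (intro eq_vecI) (auto simp: R_def coeff_sum)
  ultimately show ?thesis
    by (simp add: Ilow_Iup_mult_vec[OF d3] c_def Rx_def Ry_def g_def)
qed

section \<open>The correspondence between abelian relations and solutions\<close>

lemma lagrange_eq_Phi:
  assumes f: "f \<in> AR d p U" and z: "z \<in> U"
  shows "(\<Sum>j\<le>d - 3. monom (Phi d p U f j z) j) = lagrange {1..d} (\<lambda>i. p i z) (\<lambda>i. f i z)"
    (is "?R = ?L")
proof (rule poly_eqI)
  fix n
  have sums: "(\<Sum>i=1..d. f i z) = 0" "(\<Sum>i=1..d. p i z * f i z) = 0"
    using f z by (auto simp: AR_def)
  \<comment> \<open>The first linear relation kills the coefficient of degree \<open>d - 1\<close>,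
    then the second that of degree \<open>d - 2\<close>; higher ones vanish by degree. So the
    truncation at \<open>d - 3\<close> in \<open>Phi\<close> loses nothing.\<close>
  have "coeff ?L n = 0" if n: "n > d - 3"
  proof -
    consider "n = d - 1" | "n = d - 2" | "n > d - 1" using n d3 by force
    then show ?thesis
    proof cases
      case 1
      then show ?thesis using coeff_lagrange_top[of "{1..d}" "\<lambda>i. p i z" "\<lambda>i. f i z"] sums by simp
    next
      case 2
      then show ?thesis
        using coeff_lagrange_subtop[of "{1..d}" "\<lambda>i. f i z" "\<lambda>i. p i z"] sums d3 by simp
    next
      case 3
      then show ?thesis using degree_lagrange[of "{1..d}" "\<lambda>i. p i z" "\<lambda>i. f i z"]
        by (intro coeff_eq_0) simp
    qed
  qed
  then show "coeff ?R n = coeff ?L n"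
    using z by (auto simp: coeff_sum Phi_def lagrange_def)
qed

lemma Phi_holo:
  assumes f: "f \<in> AR d p U" and j: "j \<le> d - 3"
  shows "holo2 U (Phi d p U f j)"
proof (rule holo2_cong[OF _ U])
  have lin: "holo2 U (\<lambda>z. coeff [:- p k z, 1:] n)" if "k \<in> {1..d}" for k n
  proof -
    have "holo2 U (\<lambda>z. - p k z)" using p_holo that by (intro holo2_uminus) auto
    then show ?thesis
      by (cases n) (auto simp: coeff_pCons holo2_const split: nat.split)
  qed
  show "holo2 U (\<lambda>z. \<Sum>i=1..d. f i z * coeff (\<Prod>k\<in>{1..d} - {i}. [:- p k z, 1:]) j)"
    using f lin by (intro holo2_sum holo2_mult holo2_coeff_prod) (auto simp: AR_def)
qed (use j in \<open>simp add: Phi_def coeff_sum\<close>)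

text \<open>The residue of r / F at p = p_i, the denominator being F'_p(p_i). The value 0 elsewhere
  matches the normalization in \<open>AR\<close>.\<close>

definition residues :: "(nat \<Rightarrow> pt \<Rightarrow> complex) \<Rightarrow> nat \<Rightarrow> pt \<Rightarrow> complex" where
  "residues r i z = (if i \<in> {1..d} \<and> z \<in> U
    then poly (\<Sum>j\<le>d - 3. monom (r j z) j) (p i z) / (\<Prod>k\<in>{1..d} - {i}. p i z - p k z) else 0)"

lemma root_diff_prod_nonzero:
  "z \<in> U \<Longrightarrow> i \<in> {1..d} \<Longrightarrow> (\<Prod>k\<in>{1..d} - {i}. p i z - p k z) \<noteq> 0"
  using distinct by auto

lemma residues_holo:
  assumes r: "\<And>j. j \<le> d - 3 \<Longrightarrow> holo2 U (r j)" and i: "i \<in> {1..d}"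
  shows "holo2 U (residues r i)"
proof (rule holo2_cong[OF _ U])
  show "holo2 U (\<lambda>z. (\<Sum>j\<le>d - 3. r j z * p i z ^ j)
      * inverse (\<Prod>k\<in>{1..d} - {i}. p i z - p k z))"
    using r i p_holo root_diff_prod_nonzero
    by (intro holo2_mult holo2_inverse holo2_sum holo2_prod holo2_diff holo2_power) auto
qed (use i in \<open>simp add: residues_def poly_sum poly_monom divide_inverse\<close>)

lemma lagrange_residues:
  assumes z: "z \<in> U"
  shows "(\<Sum>j\<le>d - 3. monom (r j z) j) = lagrange {1..d} (\<lambda>i. p i z) (\<lambda>i. residues r i z)"
proof (rule lagrange_unique[OF _ inj_on_roots[OF z]])
  have "degree (\<Sum>j\<le>d - 3. monom (r j z) j) \<le> d - 3"
    by (intro degree_sum_le order_trans[OF degree_monom_le]) auto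
  then show "degree (\<Sum>j\<le>d - 3. monom (r j z) j) < card {1..d}"
    using d3 by simp
qed (use z root_diff_prod_nonzero in \<open>auto simp: residues_def\<close>)

text \<open>As r has degree at most \<open>d - 3\<close>, the coefficients of degrees
  \<open>d - 1\<close> and \<open>d - 2\<close> in its interpolation formula vanish. The first is
  the plain sum; once that is 0, the second is the weighted sum.\<close>

lemma residues_sums:
  assumes z: "z \<in> U"
  shows "(\<Sum>i=1..d. residues r i z) = 0" "(\<Sum>i=1..d. p i z * residues r i z) = 0"
proof -
  let ?L = "lagrange {1..d} (\<lambda>i. p i z) (\<lambda>i. residues r i z)"
  have zero: "coeff ?L n = 0" if "n > d - 3" for n
    unfolding lagrange_residues[OF z, symmetric] using that by (simp add: coeff_sum)
  show *: "(\<Sum>i=1..d. residues r i z) = 0"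
    using coeff_lagrange_top[of "{1..d}" "\<lambda>i. p i z" "\<lambda>i. residues r i z"] zero[of "d - 1"] d3
    by simp
  show "(\<Sum>i=1..d. p i z * residues r i z) = 0"
    using coeff_lagrange_subtop[OF _ _ *, of "\<lambda>i. p i z"] zero[of "d - 2"] d3 by simp
qed

text \<open>Interpolation shows that \<open>residues\<close> inverts \<open>Phi\<close> on both
  sides, and \<open>web_equation_iff\<close> carries the differential equations across in both
  directions.\<close>

lemma bij_betw_Phi:
  assumes T: "\<forall>z\<in>U. T z \<in> carrier_mat (d - 1) d \<and> T z * Bmat d a z = 1\<^sub>m (d - 1)"
  shows "bij_betw (Phi d p U) (AR d p U) (Sol d a U T)"
proof (rule bij_betw_byWitness[where f' = residues])
  show "\<forall>f\<in>AR d p U. residues (Phi d p U f) = f"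
  proof (intro ballI ext)
    fix f i z assume f: "f \<in> AR d p U"
    show "residues (Phi d p U f) i z = f i z"
    proof (cases "i \<in> {1..d} \<and> z \<in> U")
      case True
      then show ?thesis
        using poly_lagrange_node[of "{1..d}" i "\<lambda>i. p i z" "\<lambda>i. f i z"]
          root_diff_prod_nonzero[of z i]
        by (simp add: residues_def lagrange_eq_Phi[OF f])
    next
      case False
      \<comment> \<open>Off \<open>U\<close> and for indices outside \<open>1..d\<close> both sides
        are 0 by normalization, so the functions agree at all arguments.\<close>
      moreover have "\<forall>i z. (i \<notin> {1..d} \<or> z \<notin> U) \<longrightarrow> f i z = 0" using f unfolding AR_def by blast
      ultimately show ?thesis unfolding residues_def by metis
    qed
  qed
  show "\<forall>r\<in>Sol d a U T. Phi d p U (residues r) = r"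
  proof (intro ballI ext)
    fix r j z assume r: "r \<in> Sol d a U T"
    show "Phi d p U (residues r) j z = r j z"
    proof (cases "j \<le> d - 3 \<and> z \<in> U")
      case True
      then show ?thesis
        by (simp add: Phi_def lagrange_def[symmetric] lagrange_residues[symmetric] coeff_sum
            del: One_nat_def)
    next
      case False
      moreover have "\<forall>j z. (d - 3 < j \<or> z \<notin> U) \<longrightarrow> r j z = 0" using r unfolding Sol_def by blast
      ultimately show ?thesis unfolding Phi_def by (metis not_le)
    qed
  qed
  show "Phi d p U ` AR d p U \<subseteq> Sol d a U T"
  proof (intro image_subsetI)
    fix f assume f: "f \<in> AR d p U"
    have "Ilow d *\<^sub>v vec (d - 2) (\<lambda>j. dx (Phi d p U f j) z)
        + Iup d *\<^sub>v vec (d - 2) (\<lambda>j. dy (Phi d p U f j) z)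
        = (- (T z * Emat d a z)) *\<^sub>v vec (d - 2) (\<lambda>j. Phi d p U f j z)" if z: "z \<in> U" for z
      using f T z
      by (subst web_equation_iff[OF Phi_holo[OF f] _ lagrange_eq_Phi[OF f]]) (auto simp: AR_def)
    then show "Phi d p U f \<in> Sol d a U T"
      using Phi_holo[OF f] by (auto simp: Sol_def Phi_def)
  qed
  show "residues ` Sol d a U T \<subseteq> AR d p U"
  proof (intro image_subsetI)
    fix r assume r: "r \<in> Sol d a U T"
    have r_holo: "holo2 U (r j)" if "j \<le> d - 3" for j using r that by (simp add: Sol_def)
    have "\<forall>i\<in>{1..d}. dx (residues r i) z + dy (\<lambda>w. p i w * residues r i w) z = 0"
      if z: "z \<in> U" for z
      using r T z residues_sums
      by (subst web_equation_iff[OF r_holo residues_holo[OF r_holo] lagrange_residues, symmetric])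
        (auto simp: Sol_def)
    then show "residues r \<in> AR d p U"
      using residues_holo[OF r_holo] residues_sums by (auto simp: AR_def residues_def)
  qed
qed

end

theorem theorem1:
  fixes d :: nat and U :: "pt set" and a p :: "nat \<Rightarrow> pt \<Rightarrow> complex"
    and T :: "pt \<Rightarrow> complex mat"
  assumes "d \<ge> 3"
    and "open U"
    and "\<forall>z\<in>U. a 0 z = 1"
    and "\<forall>i\<in>{1..d}. holo2 U (a i)"
    and "\<forall>i\<in>{1..d}. holo2 U (p i)"
    and "\<forall>z\<in>U. \<forall>t. (\<Sum>i\<le>d. a i z * t ^ (d - i)) = (\<Prod>i=1..d. t - p i z)"
    and "\<forall>z\<in>U. \<forall>i\<in>{1..d}. \<forall>j\<in>{1..d}. i \<noteq> j \<longrightarrow> p i z \<noteq> p j z"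
    and "\<forall>z\<in>U. T z \<in> carrier_mat (d - 1) d \<and> T z * Bmat d a z = 1\<^sub>m (d - 1)"
  shows "bij_betw (Phi d p U) (AR d p U) (Sol d a U T)"
  using bij_betw_Phi[OF assms] .

end
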